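(* Let $d\mu=\mu(x)\,dx$ be a positive measure on $\mathbb{R}^N$ with density $\mu\in L^1_{loc}(\mathbb{R}^N)$. Assume that $N_0:=\sup\{\delta\in\mathbb{R}:|x|^{-\delta}\in L^1_{loc}(\mathbb{R}^N,d\mu)\}$ exists (as a real number), that $$\limsup_{\lambda\to0^+}\lambda\int_{B_1}|x|^{\lambda-N_0}\,d\mu=+\infty,$$ and that $N_0>2$. Let $c=c_0(N_0):=\left(\frac{N_0-2}{2}\right)^2$. Then for every constant $C$ there exists a function $\varphi\in H^1_\mu$ for which the weighted Hardy inequality $$c\int_{\mathbb{R}^N}\frac{\varphi^2}{|x|^2}\,d\mu\le\int_{\mathbb{R}^N}|\nabla\varphi|^2\,d\mu+C\int_{\mathbb{R}^N}\varphi^2\,d\mu$$ does not hold.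
   Context: $B_1$ denotes the open unit ball of $\mathbb{R}^N$ centered at $0$. $L^2_\mu:=L^2(\mathbb{R}^N,d\mu)$, and $H^1_\mu$ is the Sobolev space of functions in $L^2_\mu$ whose weak first derivatives belong to $L^2_\mu$. Functions are real-valued. *)

theory Defs
  imports "HOL-Analysis.Analysis"
begin

text \<open>The space \<open>\<real>\<^sup>N\<close> is an arbitrary type of class \<^class>\<open>euclidean_space\<close>; its coordinate
  directions are the elements of \<^term>\<open>Basis\<close>. Densities and functions are only required to be
  Lebesgue measurable, hence \<^term>\<open>lebesgue\<close> rather than \<^term>\<open>lborel\<close>.\<close>

definition weighted_measure :: "('a::euclidean_space \<Rightarrow> real) \<Rightarrow> 'a measure" where
  "weighted_measure \<mu> = density lebesgue (\<lambda>x. ennreal (\<mu> x))"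

definition locally_integrable ::
    "'a::euclidean_space measure \<Rightarrow> ('a \<Rightarrow> 'b::euclidean_space) \<Rightarrow> bool" where
  "locally_integrable M f \<longleftrightarrow> (\<forall>K. compact K \<longrightarrow> set_integrable M K f)"

definition square_integrable ::
    "'a measure \<Rightarrow> ('a \<Rightarrow> 'b::euclidean_space) \<Rightarrow> bool" where
  "square_integrable M f \<longleftrightarrow> f \<in> borel_measurable M \<and> integrable M (\<lambda>x. (norm (f x))\<^sup>2)"

abbreviation partial_deriv :: "'a::euclidean_space \<Rightarrow> ('a \<Rightarrow> real) \<Rightarrow> 'a \<Rightarrow> real" where
  "partial_deriv i f \<equiv> (\<lambda>x. frechet_derivative f (at x) i)"

fun C_times :: "nat \<Rightarrow> ('a::euclidean_space \<Rightarrow> real) \<Rightarrow> bool" where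
  "C_times 0 f \<longleftrightarrow> continuous_on UNIV f"
| "C_times (Suc k) f \<longleftrightarrow>
     (\<forall>x. f differentiable (at x)) \<and> (\<forall>i\<in>Basis. C_times k (partial_deriv i f))"

definition test_function :: "('a::euclidean_space \<Rightarrow> real) \<Rightarrow> bool" where
  "test_function \<psi> \<longleftrightarrow> (\<forall>k. C_times k \<psi>) \<and> compact (closure {x. \<psi> x \<noteq> 0})"

text \<open>The weak (distributional) gradient is taken with respect to Lebesgue measure, not with respect
  to \<open>d\<mu>\<close>. It is a relation because it determines the gradient only almost everywhere.\<close>

definition has_weak_gradient :: "('a::euclidean_space \<Rightarrow> real) \<Rightarrow> ('a \<Rightarrow> 'a) \<Rightarrow> bool" where
  "has_weak_gradient \<phi> g \<longleftrightarrow>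
     locally_integrable lebesgue \<phi> \<and> locally_integrable lebesgue g \<and>
     (\<forall>\<psi>. test_function \<psi> \<longrightarrow>
        (\<forall>i\<in>Basis. (\<integral>x. \<phi> x * partial_deriv i \<psi> x \<partial>lebesgue) =
                    - (\<integral>x. (g x \<bullet> i) * \<psi> x \<partial>lebesgue)))"

definition H1 :: "('a::euclidean_space \<Rightarrow> real) \<Rightarrow> ('a \<Rightarrow> real) set" where
  "H1 \<mu> = {\<phi>. square_integrable (weighted_measure \<mu>) \<phi> \<and>
     (\<exists>g. has_weak_gradient \<phi> g \<and>
        (\<forall>i\<in>Basis. square_integrable (weighted_measure \<mu>) (\<lambda>x. g x \<bullet> i)))}"

text \<open>The exponents \<open>\<delta>\<close> with \<open>|x|\<^sup>-\<^sup>\<delta>\<close> locally integrable against \<open>d\<mu>\<close>. The value of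
  \<^term>\<open>norm x powr (- \<delta>)\<close> at the origin, where it is \<open>0\<close>, is irrelevant: the origin is a null set.\<close>

definition integrable_exponents :: "('a::euclidean_space \<Rightarrow> real) \<Rightarrow> real set" where
  "integrable_exponents \<mu> =
     {\<delta>. locally_integrable (weighted_measure \<mu>) (\<lambda>x. norm x powr (- \<delta>))}"

definition N0 :: "('a::euclidean_space \<Rightarrow> real) \<Rightarrow> real" where
  "N0 \<mu> = Sup (integrable_exponents \<mu>)"

definition c0 :: "real \<Rightarrow> real" where
  "c0 n = ((n - 2) / 2)\<^sup>2"

text \<open>Here \<open>g\<close> plays the role of \<open>\<nabla>\<phi>\<close>. The sides are extended reals: the left-hand
  integral may be infinite, in which case the inequality fails for \<open>c > 0\<close> and \<open>\<phi>\<close> in \<open>H1 \<mu>\<close>,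
  and the right-hand side may be negative, since \<open>C\<close> is an arbitrary real.\<close>

definition weighted_hardy ::
    "('a::euclidean_space \<Rightarrow> real) \<Rightarrow> real \<Rightarrow> real \<Rightarrow> ('a \<Rightarrow> real) \<Rightarrow> ('a \<Rightarrow> 'a) \<Rightarrow> bool" where
  "weighted_hardy \<mu> c C \<phi> g \<longleftrightarrow>
     ereal c * enn2ereal (\<integral>\<^sup>+x. ennreal ((\<phi> x)\<^sup>2 / (norm x)\<^sup>2) \<partial>weighted_measure \<mu>)
     \<le> enn2ereal (\<integral>\<^sup>+x. ennreal ((norm (g x))\<^sup>2) \<partial>weighted_measure \<mu>)
       + ereal C * enn2ereal (\<integral>\<^sup>+x. ennreal ((\<phi> x)\<^sup>2) \<partial>weighted_measure \<mu>)"

end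

theory Submission
  imports Defs
begin

text \<open>With \<open>\<gamma> = (2 - N\<^sub>0 + \<lambda>) / 2\<close>, test the inequality on \<open>|x|\<^sup>\<gamma> - 1\<close> in the unit ball, truncated to a constant
  for \<open>|x| \<le> \<epsilon>\<close> and extended by \<open>0\<close>. The truncation is essential: \<open>|x|\<^sup>\<gamma>\<close> itself may fail to be locally
  Lebesgue integrable, since \<open>N\<^sub>0\<close> can exceed \<open>N\<close>, whereas the truncated function is Lipschitz with
  compact support, so its pointwise gradient is a weak gradient. The gradient term is
  \<open>\<gamma>\<^sup>2\<close> times the integral \<open>S\<close> of \<open>|x|\<close> to the power \<open>2\<gamma> - 2 = \<lambda> - N\<^sub>0\<close> over \<open>\<epsilon> < |x| < 1\<close>, and all terms
  other than \<open>c\<^sub>0 S\<close> on the left and \<open>\<gamma>\<^sup>2 S\<close> on the right are bounded uniformly in \<open>\<epsilon>\<close> and \<open>\<lambda>\<close>. As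
  \<open>c\<^sub>0 - \<gamma>\<^sup>2\<close> is at least a multiple of \<open>\<lambda>\<close>, the inequality would bound \<open>\<lambda> S\<close>, against the limsup
  hypothesis after letting \<open>\<epsilon>\<close> tend to \<open>0\<close>.\<close>

section \<open>Integration by parts for compactly supported Lipschitz functions\<close>

lemma bounded_of_continuous_vanishing_outside_compact:
  fixes f :: "'a::topological_space \<Rightarrow> 'b::real_normed_vector"
  assumes "continuous_on UNIV f" "compact K" "\<And>x. x \<notin> K \<Longrightarrow> f x = 0"
  obtains B where "0 \<le> B" "\<And>x. norm (f x) \<le> B"
proof -
  have "compact (f ` K)"
    using assms by (meson compact_continuous_image continuous_on_subset top_greatest)
  then obtain B where B: "\<And>y. y \<in> f ` K \<Longrightarrow> norm y \<le> B"
    using compact_imp_bounded bounded_iff by metis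
  have "norm (f x) \<le> max B 0" for x
    using B[of "f x"] assms(3)[of x] by (cases "x \<in> K") auto
  then show thesis by (intro that[of "max B 0"]) auto
qed

lemma integrable_continuous_vanishing_outside_compact:
  fixes f :: "'a::euclidean_space \<Rightarrow> real"
  assumes "continuous_on UNIV f" "compact K" "\<And>x. x \<notin> K \<Longrightarrow> f x = 0"
  shows "integrable lborel f"
proof -
  have "integrable lborel (\<lambda>x. indicator K x *\<^sub>R f x)"
    using assms by (intro borel_integrable_compact) (auto intro: continuous_on_subset)
  also have "(\<lambda>x. indicator K x *\<^sub>R f x) = f"
    using assms(3) by (auto simp: indicator_def fun_eq_iff)
  finally show ?thesis .
qed

lemma lborel_integral_translation:
  fixes f :: "'a::euclidean_space \<Rightarrow> real"
  assumes "integrable lborel f"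
  shows "integrable lborel (\<lambda>x. f (x + a))" "(\<integral>x. f (x + a) \<partial>lborel) = (\<integral>x. f x \<partial>lborel)"
proof -
  have [measurable]: "f \<in> borel_measurable borel" using assms by auto
  have "integrable (distr lborel borel ((+) a)) f"
    using assms by (simp add: lborel_distr_plus)
  then show "integrable lborel (\<lambda>x. f (x + a))"
    by (subst (asm) integrable_distr_eq) (auto simp: add.commute)
  have "(\<integral>x. f x \<partial>lborel) = (\<integral>x. f x \<partial>distr lborel borel ((+) a))"
    by (simp add: lborel_distr_plus)
  also have "\<dots> = (\<integral>x. f (x + a) \<partial>lborel)"
    by (subst integral_distr) (auto simp: add.commute)
  finally show "(\<integral>x. f (x + a) \<partial>lborel) = (\<integral>x. f x \<partial>lborel)" by simp
qed

text \<open>The difference quotients have integral zero by translation invariance, and they are dominated.\<close>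

lemma lborel_integral_directional_derivative_eq_0:
  fixes F D :: "'a::euclidean_space \<Rightarrow> real"
  assumes cont: "continuous_on UNIV F" and [measurable]: "D \<in> borel_measurable borel"
    and supp: "\<And>x. x \<notin> cball 0 R \<Longrightarrow> F x = 0"
    and lip: "\<And>x h. 0 < h \<Longrightarrow> \<bar>F (x + h *\<^sub>R v) - F x\<bar> \<le> L * h"
    and deriv: "AE x in lborel. ((\<lambda>h. F (x + h *\<^sub>R v)) has_real_derivative D x) (at 0)"
  shows "(\<integral>x. D x \<partial>lborel) = 0"
proof -
  \<comment> \<open>The steps stay at most 1, so all translates of \<open>F\<close> vanish outside
    one fixed ball, and a single integrable function dominates every difference quotient.\<close>
  define h where "h n = inverse (real (Suc n))" for n
  have h: "0 < h n" "h n \<le> 1" for n by (auto simp: h_def field_simps)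
  have h0: "h \<longlonglongrightarrow> 0" unfolding h_def by (rule LIMSEQ_inverse_real_of_nat)
  have hat: "filterlim h (at 0) sequentially"
    using h0 h(1) by (auto simp: filterlim_at less_imp_neq eventually_sequentially) (metis less_irrefl)
  define s where "s n x = (F (x + h n *\<^sub>R v) - F x) / h n" for n x
  have int: "integrable lborel F"
    using integrable_continuous_vanishing_outside_compact[OF cont compact_cball supp] .
  then have [measurable]: "F \<in> borel_measurable borel" by auto
  have s0: "(\<integral>x. s n x \<partial>lborel) = 0" for n
    using lborel_integral_translation[OF int, of "h n *\<^sub>R v"] int
    by (simp add: s_def)
  have L: "0 \<le> L" using lip[of 1 0] by linarith
  have bound: "norm (s n x) \<le> L * indicator (cball 0 (R + norm v)) x" for n x
  proof (cases "x \<in> cball 0 (R + norm v)")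
    case True
    then show ?thesis using lip[OF h(1), of x n] h(1)[of n] by (auto simp: s_def field_simps)
  next
    case False
    have "norm (h n *\<^sub>R v) \<le> norm v" using h[of n] by (simp add: mult_left_le_one_le)
    moreover have "norm x \<le> norm (x + h n *\<^sub>R v) + norm (h n *\<^sub>R v)"
      using norm_triangle_ineq4[of "x + h n *\<^sub>R v" "h n *\<^sub>R v"] by simp
    ultimately have "x + h n *\<^sub>R v \<notin> cball 0 R" "x \<notin> cball 0 R"
      using False norm_ge_zero[of v] by (auto simp del: norm_ge_zero norm_scaleR)
    then show ?thesis using False by (simp add: s_def supp)
  qed
  have lim: "AE x in lborel. (\<lambda>n. s n x) \<longlonglongrightarrow> D x"
    using deriv
  proof (eventually_elim)
    case (elim x)
    then have "((\<lambda>h. (F (x + h *\<^sub>R v) - F x) / h) \<longlongrightarrow> D x) (at 0)"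
      by (simp add: DERIV_def)
    from filterlim_compose[OF this hat] show ?case by (simp add: s_def)
  qed
  have dom: "integrable lborel (\<lambda>x::'a. L * indicator (cball 0 (R + norm v)) x)"
    using emeasure_compact_finite[OF compact_cball[of "0::'a" "R + norm v"]]
    by (intro integrable_mult_right integrable_real_indicator) auto
  have "(\<lambda>n. \<integral>x. s n x \<partial>lborel) \<longlonglongrightarrow> (\<integral>x. D x \<partial>lborel)"
    by (rule integral_dominated_convergence[OF _ _ dom lim])
       (use bound in \<open>auto simp: s_def[abs_def]\<close>)
  then show ?thesis by (simp add: s0 LIMSEQ_const_iff)
qed

lemma test_function_regular:
  assumes "test_function \<psi>"
  shows "continuous_on UNIV \<psi>" "\<psi> differentiable (at x)"
    and "i \<in> Basis \<Longrightarrow> continuous_on UNIV (partial_deriv i \<psi>)"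
proof -
  have "C_times 0 \<psi>" "C_times (Suc 0) \<psi>" using assms unfolding test_function_def by blast+
  then show "continuous_on UNIV \<psi>" "\<psi> differentiable (at x)"
    "i \<in> Basis \<Longrightarrow> continuous_on UNIV (partial_deriv i \<psi>)" by auto
qed

lemma partial_deriv_eq_0_outside_support:
  fixes \<psi> :: "'a::euclidean_space \<Rightarrow> real"
  assumes "x \<notin> closure {x. \<psi> x \<noteq> 0}"
  shows "partial_deriv i \<psi> x = 0"
proof -
  have "(\<psi> has_derivative (\<lambda>_. 0)) (at x)"
    by (rule has_derivative_transform_within_open[of "\<lambda>_. 0" _ _ UNIV "- closure {x. \<psi> x \<noteq> 0}"])
       (use assms closure_subset[of "{x. \<psi> x \<noteq> 0}"] in auto)
  then show ?thesis by (metis frechet_derivative_at)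
qed

lemma has_real_derivative_along_line:
  assumes "(f has_derivative f') (at (x + t *\<^sub>R v))"
  shows "((\<lambda>h. f (x + h *\<^sub>R v)) has_real_derivative f' v) (at t)"
proof -
  have "((\<lambda>h. x + h *\<^sub>R v) has_derivative (\<lambda>h. h *\<^sub>R v)) (at t)"
    by (auto intro!: derivative_eq_intros)
  from has_derivative_compose[OF this assms]
  have "((\<lambda>h. f (x + h *\<^sub>R v)) has_derivative (\<lambda>h. f' (h *\<^sub>R v))) (at t)" .
  moreover have "f' (h *\<^sub>R v) = f' v * h" for h
    using has_derivative_linear[OF assms] by (simp add: linear_cmul)
  ultimately show ?thesis by (simp add: has_field_derivative_def)
qed

text \<open>The mean value theorem on a segment. Only the derivative in direction \<open>v\<close>
  is bounded, which suits a test function controlled through one partial derivative.\<close>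

lemma directional_increment_bound:
  fixes f :: "'a::real_normed_vector \<Rightarrow> real"
  assumes "\<And>x. (f has_derivative f' x) (at x)" "\<And>x. \<bar>f' x v\<bar> \<le> B" "0 < h"
  shows "\<bar>f (x + h *\<^sub>R v) - f x\<bar> \<le> B * h"
proof -
  have "\<exists>z>0. z < h \<and> f (x + h *\<^sub>R v) - f (x + 0 *\<^sub>R v) = (h - 0) * f' (x + z *\<^sub>R v) v"
    using assms by (intro MVT2 has_real_derivative_along_line) auto
  then obtain z where "f (x + h *\<^sub>R v) - f x = h * f' (x + z *\<^sub>R v) v" by auto
  then show ?thesis using assms by (simp add: abs_mult mult.commute)
qed

lemma locally_integrable_lebesgue_bounded:
  fixes f :: "'a::euclidean_space \<Rightarrow> 'b::euclidean_space"
  assumes [measurable]: "f \<in> borel_measurable borel" and "\<And>x. norm (f x) \<le> B"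
  shows "locally_integrable lebesgue f"
  unfolding locally_integrable_def set_integrable_def
proof (intro allI impI)
  fix K :: "'a set" assume K: "compact K"
  have [measurable]: "f \<in> borel_measurable lebesgue" "K \<in> sets lebesgue"
    using K by (auto simp: measurable_completion borel_compact)
  have "emeasure lebesgue K < \<infinity>"
    using emeasure_compact_finite[OF K] K by (simp add: borel_compact main_part_sets)
  then have "integrable lebesgue (\<lambda>x. B * indicator K x)"
    by (intro integrable_mult_right integrable_real_indicator) auto
  then show "integrable lebesgue (\<lambda>x. indicator K x *\<^sub>R f x)"
    by (rule Bochner_Integration.integrable_bound)
       (use assms(2) in \<open>auto simp: indicator_def order_trans[OF _ abs_ge_self]\<close>)
qed

text \<open>The product of \<open>\<phi>\<close> with a test function is continuous, compactly
  supported and Lipschitz along each coordinate direction, so its derivative in that direction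
  integrates to zero. The product rule, valid almost everywhere, splits this into the two sides of
  the weak gradient identity.\<close>

lemma has_weak_gradient_Lipschitz:
  fixes \<phi> :: "'a::euclidean_space \<Rightarrow> real"
  assumes lip: "L-lipschitz_on UNIV \<phi>" and supp: "\<And>x. x \<notin> cball 0 R \<Longrightarrow> \<phi> x = 0"
    and g[measurable]: "g \<in> borel_measurable borel" and bg: "\<And>x. norm (g x) \<le> B"
    and deriv: "AE x in lborel. (\<phi> has_derivative (\<lambda>v. g x \<bullet> v)) (at x)"
  shows "has_weak_gradient \<phi> g"
proof -
  have cont: "continuous_on UNIV \<phi>" using lip by (rule lipschitz_on_continuous_on)
  then have [measurable]: "\<phi> \<in> borel_measurable borel" by (rule borel_measurable_continuous_onI)
  obtain B\<phi> where B\<phi>: "0 \<le> B\<phi>" "\<And>x. norm (\<phi> x) \<le> B\<phi>"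
    using bounded_of_continuous_vanishing_outside_compact[OF cont compact_cball supp] by blast
  have "(\<integral>x. \<phi> x * partial_deriv i \<psi> x \<partial>lebesgue) = - (\<integral>x. (g x \<bullet> i) * \<psi> x \<partial>lebesgue)"
    if \<psi>: "test_function \<psi>" and i: "i \<in> Basis" for \<psi> i
  proof -
    define K where "K = closure {x. \<psi> x \<noteq> 0}"
    have K: "compact K" using \<psi> by (simp add: test_function_def K_def)
    have \<psi>0: "x \<notin> K \<Longrightarrow> \<psi> x = 0" for x
      unfolding K_def using closure_subset[of "{x. \<psi> x \<noteq> 0}"] by auto
    have d0: "x \<notin> K \<Longrightarrow> partial_deriv i \<psi> x = 0" for x
      unfolding K_def by (rule partial_deriv_eq_0_outside_support)
    note c\<psi> = test_function_regular(1)[OF \<psi>]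
    note cd = test_function_regular(3)[OF \<psi> i]
    have D\<psi>: "(\<psi> has_derivative frechet_derivative \<psi> (at x)) (at x)" for x
      using test_function_regular(2)[OF \<psi>] frechet_derivative_works by blast
    have [measurable]: "\<psi> \<in> borel_measurable borel" "partial_deriv i \<psi> \<in> borel_measurable borel"
      using c\<psi> cd by (auto intro: borel_measurable_continuous_onI)
    obtain B\<psi> where B\<psi>: "0 \<le> B\<psi>" "\<And>x. norm (\<psi> x) \<le> B\<psi>"
      using bounded_of_continuous_vanishing_outside_compact[OF c\<psi> K \<psi>0] by blast
    obtain Bd where Bd: "0 \<le> Bd" "\<And>x. norm (partial_deriv i \<psi> x) \<le> Bd"
      using bounded_of_continuous_vanishing_outside_compact[OF cd K d0] by blast
    define D where "D x = \<phi> x * partial_deriv i \<psi> x + (g x \<bullet> i) * \<psi> x" for x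
    \<comment> \<open>One factor changes at a time, while the other is bounded.\<close>
    have incr: "\<bar>\<phi> (x + h *\<^sub>R i) * \<psi> (x + h *\<^sub>R i) - \<phi> x * \<psi> x\<bar> \<le> (B\<phi> * Bd + L * B\<psi>) * h"
      if "0 < h" for x h
    proof -
      have 1: "\<bar>\<psi> (x + h *\<^sub>R i) - \<psi> x\<bar> \<le> Bd * h"
        using Bd by (intro directional_increment_bound[OF D\<psi> _ that]) auto
      have 2: "\<bar>\<phi> (x + h *\<^sub>R i) - \<phi> x\<bar> \<le> L * h"
        using lipschitz_onD[OF lip, of "x + h *\<^sub>R i" x] that i by (simp add: dist_norm)
      have "\<phi> (x + h *\<^sub>R i) * \<psi> (x + h *\<^sub>R i) - \<phi> x * \<psi> x
          = \<phi> (x + h *\<^sub>R i) * (\<psi> (x + h *\<^sub>R i) - \<psi> x) + (\<phi> (x + h *\<^sub>R i) - \<phi> x) * \<psi> x"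
        by (simp add: algebra_simps)
      also have "\<bar>\<dots>\<bar> \<le> \<bar>\<phi> (x + h *\<^sub>R i)\<bar> * \<bar>\<psi> (x + h *\<^sub>R i) - \<psi> x\<bar> + \<bar>\<phi> (x + h *\<^sub>R i) - \<phi> x\<bar> * \<bar>\<psi> x\<bar>"
        by (metis abs_mult abs_triangle_ineq)
      also have "\<dots> \<le> B\<phi> * (Bd * h) + (L * h) * B\<psi>"
        using 1 2 B\<phi> B\<psi> by (intro add_mono mult_mono) (auto intro: order_trans[OF abs_ge_zero])
      finally show ?thesis by (simp add: algebra_simps)
    qed
    have "(\<integral>x. D x \<partial>lborel) = 0"
    proof (rule lborel_integral_directional_derivative_eq_0[where F = "\<lambda>x. \<phi> x * \<psi> x" and v = i])
      show "continuous_on UNIV (\<lambda>x. \<phi> x * \<psi> x)" using cont c\<psi> by (intro continuous_intros)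
      show "D \<in> borel_measurable borel" unfolding D_def by measurable
      show "AE x in lborel. ((\<lambda>h. \<phi> (x + h *\<^sub>R i) * \<psi> (x + h *\<^sub>R i)) has_real_derivative D x) (at 0)"
        using deriv
      proof eventually_elim
        case (elim x)
        have "((\<lambda>x. \<phi> x * \<psi> x) has_derivative
            (\<lambda>v. \<phi> x * frechet_derivative \<psi> (at x) v + (g x \<bullet> v) * \<psi> x)) (at x)"
          by (rule has_derivative_mult[OF elim D\<psi>])
        then show ?case
          using has_real_derivative_along_line[of "\<lambda>x. \<phi> x * \<psi> x" _ x 0 i] by (simp add: D_def)
      qed
    qed (use supp incr in auto)
    moreover have "integrable lborel (\<lambda>x. \<phi> x * partial_deriv i \<psi> x)"
      using cont cd d0 by (intro integrable_continuous_vanishing_outside_compact[OF _ K] continuous_intros) auto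
    moreover have "integrable lborel (\<lambda>x. (g x \<bullet> i) * \<psi> x)"
    proof (rule Bochner_Integration.integrable_bound)
      show "integrable lborel (\<lambda>x. B * \<bar>\<psi> x\<bar>)"
        using integrable_continuous_vanishing_outside_compact[OF c\<psi> K \<psi>0] by simp
      have "\<bar>g x \<bullet> i\<bar> \<le> B" for x
        using Basis_le_norm[OF i, of "g x"] bg[of x] by simp
      then show "AE x in lborel. norm ((g x \<bullet> i) * \<psi> x) \<le> norm (B * \<bar>\<psi> x\<bar>)"
        by (intro AE_I2) (auto simp: abs_mult intro!: mult_right_mono intro: order_trans[OF _ abs_ge_self])
    qed simp
    \<comment> \<open>All integrands are Borel, so their integrals over \<open>lebesgue\<close> and
      \<open>lborel\<close> agree.\<close>
    ultimately show ?thesis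
      by (simp add: integral_completion D_def)
  qed
  then show ?thesis
    unfolding has_weak_gradient_def
    using locally_integrable_lebesgue_bounded[of \<phi> B\<phi>] locally_integrable_lebesgue_bounded[of g B] B\<phi> bg
    by auto
qed

text \<open>The cut-offs of \<open>f\<close> to the balls of radius \<open>n\<close> are measurable
  and eventually agree with \<open>f\<close> at each point.\<close>

lemma borel_measurable_of_locally_integrable:
  fixes f :: "'a::euclidean_space \<Rightarrow> real"
  assumes "locally_integrable lebesgue f"
  shows "f \<in> borel_measurable lebesgue"
proof (rule borel_measurable_LIMSEQ_real)
  show "(\<lambda>x. indicator (cball 0 (real n)) x *\<^sub>R f x) \<in> borel_measurable lebesgue" for n
    using assms unfolding locally_integrable_def set_integrable_def
    by (intro borel_measurable_integrable) auto
  show "(\<lambda>n. indicator (cball 0 (real n)) x *\<^sub>R f x) \<longlonglongrightarrow> f x" for x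
  proof (rule tendsto_eventually)
    obtain m :: nat where m: "norm x \<le> real m" using real_arch_simple by blast
    show "\<forall>\<^sub>F n in sequentially. indicator (cball 0 (real n)) x *\<^sub>R f x = f x"
      using eventually_ge_at_top[of m] by eventually_elim (use m in \<open>auto simp: indicator_def\<close>)
  qed
qed

section \<open>Integrability with respect to the weighted measure\<close>

lemma sets_weighted_measure [simp, measurable_cong]: "sets (weighted_measure \<mu>) = sets lebesgue"
  by (simp add: weighted_measure_def)

lemma space_weighted_measure [simp]: "space (weighted_measure \<mu>) = UNIV"
  by (simp add: weighted_measure_def)

lemma borel_measurable_weighted_measure:
  "f \<in> borel_measurable borel \<Longrightarrow> f \<in> borel_measurable (weighted_measure \<mu>)"
  by (simp add: measurable_completion cong: measurable_cong_sets)

lemma emeasure_weighted_measure_compact: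
  fixes \<mu> :: "'a::euclidean_space \<Rightarrow> real"
  assumes \<mu>: "locally_integrable lebesgue \<mu>" and K: "compact K"
  shows "emeasure (weighted_measure \<mu>) K < \<infinity>"
proof -
  have [measurable]: "\<mu> \<in> borel_measurable lebesgue"
    using \<mu> by (rule borel_measurable_of_locally_integrable)
  have "emeasure (weighted_measure \<mu>) K = (\<integral>\<^sup>+x. ennreal (\<mu> x) * indicator K x \<partial>lebesgue)"
    unfolding weighted_measure_def using K by (intro emeasure_density) (auto simp: borel_compact)
  \<comment> \<open>\<open>ennreal\<close> sends negative values to 0, so the density is at most the
    absolute value of \<open>\<mu>\<close> at every point.\<close>
  also have "\<dots> \<le> (\<integral>\<^sup>+x. ennreal (norm (indicator K x *\<^sub>R \<mu> x)) \<partial>lebesgue)"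
    by (intro nn_integral_mono) (auto simp: indicator_def intro: ennreal_leI)
  also have "\<dots> < \<infinity>"
    using \<mu> K unfolding locally_integrable_def set_integrable_def integrable_iff_bounded by blast
  finally show ?thesis .
qed

text \<open>Negative powers of the norm take the value 0 at the origin by the convention for
  \<open>powr\<close>, so upper bounds by such powers are claimed only off the origin.\<close>

lemma AE_weighted_measure_nonzero:
  fixes \<mu> :: "'a::euclidean_space \<Rightarrow> real"
  assumes "\<mu> \<in> borel_measurable lebesgue"
  shows "AE x in weighted_measure \<mu>. x \<noteq> 0"
proof -
  have "AE x in lborel. x \<noteq> (0::'a)" by (rule AE_lborel_singleton)
  then have "AE x in lebesgue. x \<noteq> (0::'a)" by (rule AE_completion)
  then show ?thesis
    unfolding weighted_measure_def using assms by (subst AE_density) auto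
qed

lemma integrable_weighted_measure_bounded_support:
  fixes f :: "'a::euclidean_space \<Rightarrow> real"
  assumes \<mu>: "locally_integrable lebesgue \<mu>" and K: "compact K"
    and f: "f \<in> borel_measurable borel" "\<And>x. x \<notin> K \<Longrightarrow> f x = 0" "\<And>x. \<bar>f x\<bar> \<le> B"
  shows "integrable (weighted_measure \<mu>) f"
proof (rule Bochner_Integration.integrable_bound)
  show "integrable (weighted_measure \<mu>) (\<lambda>x. B * indicator K x)"
    using emeasure_weighted_measure_compact[OF \<mu> K] K
    by (intro integrable_mult_right integrable_real_indicator) (auto simp: borel_compact)
  show "f \<in> borel_measurable (weighted_measure \<mu>)"
    using f(1) by (rule borel_measurable_weighted_measure)
  show "AE x in weighted_measure \<mu>. norm (f x) \<le> norm (B * indicator K x)"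
    by (intro AE_I2) (use f(2,3) in \<open>auto simp: indicator_def order_trans[OF _ abs_ge_self]\<close>)
qed

lemma square_integrable_weighted_measure_bounded_support:
  fixes f :: "'a::euclidean_space \<Rightarrow> real"
  assumes \<mu>: "locally_integrable lebesgue \<mu>" and K: "compact K"
    and f: "f \<in> borel_measurable borel" "\<And>x. x \<notin> K \<Longrightarrow> f x = 0" "\<And>x. \<bar>f x\<bar> \<le> B"
  shows "square_integrable (weighted_measure \<mu>) f"
  unfolding square_integrable_def
proof
  show "f \<in> borel_measurable (weighted_measure \<mu>)"
    using f(1) by (rule borel_measurable_weighted_measure)
  have "\<bar>(norm (f x))\<^sup>2\<bar> \<le> B\<^sup>2" for x
    using power_mono[OF f(3)[of x], of 2] by simp
  then show "integrable (weighted_measure \<mu>) (\<lambda>x. (norm (f x))\<^sup>2)"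
    using f by (intro integrable_weighted_measure_bounded_support[OF \<mu> K]) auto
qed

text \<open>Integrability on the unit ball passes from an exponent to every smaller one, because the
  norm is at most 1 there. Since \<open>\<delta>\<close> lies below the supremum, some admissible
  exponent exceeds it.\<close>

lemma nn_integral_powr_ball_finite:
  fixes \<mu> :: "'a::euclidean_space \<Rightarrow> real"
  assumes "integrable_exponents \<mu> \<noteq> {}" "bdd_above (integrable_exponents \<mu>)" "\<delta> < N0 \<mu>"
  shows "(\<integral>\<^sup>+x\<in>ball 0 1. ennreal (norm x powr - \<delta>) \<partial>weighted_measure \<mu>) < \<infinity>"
proof -
  obtain \<delta>' where \<delta>': "\<delta>' \<in> integrable_exponents \<mu>" "\<delta> < \<delta>'"
    using assms less_cSup_iff unfolding N0_def by metis
  have "(\<integral>\<^sup>+x\<in>ball 0 1. ennreal (norm x powr - \<delta>) \<partial>weighted_measure \<mu>)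
      \<le> (\<integral>\<^sup>+x. ennreal (norm (indicator (cball 0 1) x *\<^sub>R norm x powr - \<delta>')) \<partial>weighted_measure \<mu>)"
  proof (intro nn_integral_mono)
    fix x :: 'a
    show "ennreal (norm x powr - \<delta>) * indicator (ball 0 1) x
        \<le> ennreal (norm (indicator (cball 0 1) x *\<^sub>R norm x powr - \<delta>'))"
      using \<delta>'(2) powr_mono'[of "- \<delta>'" "- \<delta>" "norm x"]
      by (auto simp: indicator_def intro: ennreal_leI)
  qed
  also have "\<dots> < \<infinity>"
    using \<delta>'(1) compact_cball[of "0::'a" 1]
    unfolding integrable_exponents_def locally_integrable_def set_integrable_def integrable_iff_bounded
    by blast
  finally show ?thesis .
qed

section \<open>The truncated powers and their membership in the Sobolev space\<close>

text \<open>For \<open>\<epsilon>\<close> below 1 the norm is clamped to the interval from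
  \<open>\<epsilon>\<close> to 1: the lower cut removes the singularity, and the upper one lets the
  function reach 0 continuously at the unit sphere.\<close>

definition truncated_power :: "real \<Rightarrow> real \<Rightarrow> 'a::euclidean_space \<Rightarrow> real" where
  "truncated_power \<epsilon> \<gamma> x = min 1 (max \<epsilon> (norm x)) powr \<gamma> - 1"

text \<open>This is the radial derivative times the unit vector along \<open>x\<close>; the exponent
  \<open>\<gamma> - 2\<close> absorbs the normalisation of \<open>x\<close>. On the two bounding
  spheres, which are null sets, the value is set to 0.\<close>

definition truncated_power_gradient :: "real \<Rightarrow> real \<Rightarrow> 'a::euclidean_space \<Rightarrow> 'a" where
  "truncated_power_gradient \<epsilon> \<gamma> x =
     (if \<epsilon> < norm x \<and> norm x < 1 then (\<gamma> * norm x powr (\<gamma> - 2)) *\<^sub>R x else 0)"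

lemma truncated_power_outside: "x \<notin> cball 0 1 \<Longrightarrow> truncated_power \<epsilon> \<gamma> x = 0"
  by (simp add: truncated_power_def)

lemma norm_truncated_power_gradient:
  "norm (truncated_power_gradient \<epsilon> \<gamma> x) =
     (if \<epsilon> < norm x \<and> norm x < 1 then \<bar>\<gamma>\<bar> * norm x powr (\<gamma> - 1) else 0)"
proof (cases "x = 0")
  case False
  have "norm x powr (\<gamma> - 1) = norm x powr (\<gamma> - 2) * norm x powr 1"
    by (simp only: powr_add[symmetric]) simp
  then show ?thesis by (simp add: truncated_power_gradient_def abs_mult)
qed (simp add: truncated_power_gradient_def)

lemma borel_measurable_truncated_power_gradient [measurable]:
  "(truncated_power_gradient \<epsilon> \<gamma> :: 'a::euclidean_space \<Rightarrow> 'a) \<in> borel_measurable borel"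
  unfolding truncated_power_gradient_def[abs_def] by measurable

lemma borel_measurable_truncated_power [measurable]:
  "(truncated_power \<epsilon> \<gamma> :: 'a::euclidean_space \<Rightarrow> real) \<in> borel_measurable borel"
  unfolding truncated_power_def[abs_def] by measurable

context
  fixes \<epsilon> \<gamma> :: real
  assumes \<epsilon>: "0 < \<epsilon>" "\<epsilon> < 1" and \<gamma>: "\<gamma> < 0"
begin

text \<open>The clamped norm is 1-Lipschitz with values between \<open>\<epsilon>\<close> and 1, and
  on that interval the derivative of the power is largest in size at \<open>\<epsilon>\<close>,
  since \<open>\<gamma>\<close> is negative.\<close>

lemma lipschitz_on_truncated_power:
  "\<exists>L. L-lipschitz_on UNIV (truncated_power \<epsilon> \<gamma> :: 'a::euclidean_space \<Rightarrow> real)"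
proof -
  define L where "L = \<bar>\<gamma>\<bar> * \<epsilon> powr (\<gamma> - 1)"
  have p: "L-lipschitz_on {\<epsilon>..1} (\<lambda>t. t powr \<gamma>)"
  proof (rule bounded_derivative_imp_lipschitz)
    fix t assume t: "t \<in> {\<epsilon>..1}"
    show "((\<lambda>t. t powr \<gamma>) has_derivative (\<lambda>h. h * (\<gamma> * t powr (\<gamma> - 1)))) (at t within {\<epsilon>..1})"
      using t \<epsilon> has_real_derivative_powr[of t \<gamma>]
      by (auto simp: has_field_derivative_def mult.commute[of _ "_ * _"] intro: has_derivative_at_withinI)
    have "t powr (\<gamma> - 1) \<le> \<epsilon> powr (\<gamma> - 1)"
      using t \<epsilon> \<gamma> by (intro powr_mono2') auto
    then have "\<bar>\<gamma> * t powr (\<gamma> - 1)\<bar> \<le> L"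
      by (auto simp: L_def abs_mult intro: mult_left_mono)
    then have "norm (h * (\<gamma> * t powr (\<gamma> - 1))) \<le> L * norm h" for h
      using mult_right_mono[of "\<bar>\<gamma> * t powr (\<gamma> - 1)\<bar>" L "\<bar>h\<bar>"] by (simp add: abs_mult mult_ac)
    then show "onorm (\<lambda>h. h * (\<gamma> * t powr (\<gamma> - 1))) \<le> L"
      by (rule onorm_le)
  qed (auto simp: L_def)
  have c: "1-lipschitz_on UNIV (\<lambda>x::'a. min 1 (max \<epsilon> (norm x)))"
  proof (rule lipschitz_onI)
    fix x y :: 'a
    have "\<bar>norm x - norm y\<bar> \<le> dist x y" by (simp add: dist_norm norm_triangle_ineq3)
    then show "dist (min 1 (max \<epsilon> (norm x))) (min 1 (max \<epsilon> (norm y))) \<le> 1 * dist x y"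
      unfolding dist_real_def by linarith
  qed simp
  have "(\<lambda>x::'a. min 1 (max \<epsilon> (norm x))) ` UNIV \<subseteq> {\<epsilon>..1}" using \<epsilon> by auto
  then have "(L * 1)-lipschitz_on UNIV (\<lambda>x::'a. min 1 (max \<epsilon> (norm x)) powr \<gamma>)"
    using lipschitz_on_compose2[OF c lipschitz_on_subset[OF p]] by blast
  from lipschitz_on_diff[OF this lipschitz_on_constant[of UNIV 1]]
  show ?thesis unfolding truncated_power_def[abs_def] by auto
qed

lemma has_derivative_truncated_power:
  fixes x :: "'a::euclidean_space"
  assumes "norm x \<noteq> \<epsilon>" "norm x \<noteq> 1"
  shows "(truncated_power \<epsilon> \<gamma> has_derivative (\<lambda>v. truncated_power_gradient \<epsilon> \<gamma> x \<bullet> v)) (at x)"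
proof -
  consider "norm x < \<epsilon>" | "\<epsilon> < norm x" "norm x < 1" | "1 < norm x" using assms by linarith
  then show ?thesis
  proof cases
    case 1
    have "(truncated_power \<epsilon> \<gamma> has_derivative (\<lambda>_. 0)) (at x)"
      by (rule has_derivative_transform_within_open[of "\<lambda>_. \<epsilon> powr \<gamma> - 1" _ _ UNIV "ball 0 \<epsilon>"])
         (use 1 \<epsilon> in \<open>auto simp: truncated_power_def max_def\<close>)
    then show ?thesis using 1 by (simp add: truncated_power_gradient_def)
  next
    case 2
    have x: "x \<noteq> 0" using 2 \<epsilon> by auto
    have "((\<lambda>x. norm x powr \<gamma> - 1) has_derivative
        (\<lambda>v. norm x powr \<gamma> * (v \<bullet> sgn x * \<gamma> / norm x))) (at x)"
      using x by (auto intro!: derivative_eq_intros has_derivative_norm)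
    moreover have "norm x powr \<gamma> * (v \<bullet> sgn x * \<gamma> / norm x) = truncated_power_gradient \<epsilon> \<gamma> x \<bullet> v" for v
    proof -
      have "norm x powr \<gamma> = norm x powr (\<gamma> - 2) * norm x powr 2"
        by (simp only: powr_add[symmetric]) simp
      then show ?thesis
        using x 2 by (simp add: truncated_power_gradient_def sgn_div_norm powr_numeral power2_eq_square inner_commute field_simps)
    qed
    ultimately have "((\<lambda>x. norm x powr \<gamma> - 1) has_derivative
        (\<lambda>v. truncated_power_gradient \<epsilon> \<gamma> x \<bullet> v)) (at x)" by simp
    then show ?thesis
      by (rule has_derivative_transform_within_open[of _ _ _ UNIV "ball 0 1 - cball 0 \<epsilon>"])
         (use 2 in \<open>auto simp: truncated_power_def\<close>)
  next
    case 3
    have "(truncated_power \<epsilon> \<gamma> has_derivative (\<lambda>_. 0)) (at x)"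
      by (rule has_derivative_transform_within_open[of "\<lambda>_. 0" _ _ UNIV "- cball 0 1"])
         (use 3 in \<open>auto simp: truncated_power_def\<close>)
    then show ?thesis using 3 by (simp add: truncated_power_gradient_def)
  qed
qed

lemma truncated_power_gradient_bounded:
  "norm (truncated_power_gradient \<epsilon> \<gamma> x) \<le> \<bar>\<gamma>\<bar> * \<epsilon> powr (\<gamma> - 1)"
  using \<epsilon> \<gamma> by (auto simp: norm_truncated_power_gradient mult_nonpos_nonneg intro!: mult_left_mono powr_mono2')

lemma has_weak_gradient_truncated_power:
  "has_weak_gradient (truncated_power \<epsilon> \<gamma> :: 'a::euclidean_space \<Rightarrow> real) (truncated_power_gradient \<epsilon> \<gamma>)"
proof -
  obtain L where "L-lipschitz_on UNIV (truncated_power \<epsilon> \<gamma> :: 'a \<Rightarrow> real)"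
    using lipschitz_on_truncated_power by blast
  \<comment> \<open>The kinks sit on two spheres, which are null sets, so the pointwise derivative
    exists almost everywhere.\<close>
  moreover have "AE x in lborel. x \<notin> sphere (0::'a) \<epsilon> \<union> sphere 0 1"
    using negligible_sphere[of "0::'a"]
    by (intro AE_not_in) (auto simp: negligible_iff_null_sets null_sets_completion_iff)
  then have "AE x in lborel. (truncated_power \<epsilon> \<gamma> has_derivative
      (\<lambda>v. truncated_power_gradient \<epsilon> \<gamma> (x::'a) \<bullet> v)) (at x)"
    by eventually_elim (auto intro: has_derivative_truncated_power)
  ultimately show ?thesis
    by (intro has_weak_gradient_Lipschitz[OF _ truncated_power_outside _ truncated_power_gradient_bounded]) auto
qed

lemma truncated_power_in_H1:
  fixes \<mu> :: "'a::euclidean_space \<Rightarrow> real"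
  assumes \<mu>: "locally_integrable lebesgue \<mu>"
  shows "truncated_power \<epsilon> \<gamma> \<in> H1 \<mu>"
proof -
  \<comment> \<open>The clamped norm lies between \<open>\<epsilon>\<close> and 1, so its power with
    negative exponent lies between 1 and \<open>\<epsilon> powr \<gamma>\<close>.\<close>
  have "\<bar>truncated_power \<epsilon> \<gamma> x\<bar> \<le> \<epsilon> powr \<gamma>" for x :: 'a
  proof -
    have "min 1 (max \<epsilon> (norm x)) powr \<gamma> \<le> \<epsilon> powr \<gamma>"
      using \<epsilon> \<gamma> by (intro powr_mono2') auto
    moreover have "1 powr \<gamma> \<le> min 1 (max \<epsilon> (norm x)) powr \<gamma>"
      using \<epsilon> \<gamma> by (intro powr_mono2') auto
    ultimately show ?thesis by (auto simp: truncated_power_def)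
  qed
  then have "square_integrable (weighted_measure \<mu>) (truncated_power \<epsilon> \<gamma>)"
    by (intro square_integrable_weighted_measure_bounded_support[OF \<mu> compact_cball[of 0 1] _ truncated_power_outside]) auto
  moreover have "square_integrable (weighted_measure \<mu>) (\<lambda>x. truncated_power_gradient \<epsilon> \<gamma> x \<bullet> i)"
    if "i \<in> Basis" for i
  proof (rule square_integrable_weighted_measure_bounded_support[OF \<mu> compact_cball[of 0 1]])
    show "\<bar>truncated_power_gradient \<epsilon> \<gamma> x \<bullet> i\<bar> \<le> \<bar>\<gamma>\<bar> * \<epsilon> powr (\<gamma> - 1)" for x
      using Basis_le_norm[OF that] truncated_power_gradient_bounded order_trans by blast
  qed (auto simp: truncated_power_gradient_def)
  ultimately show ?thesis
    using has_weak_gradient_truncated_power unfolding H1_def by blast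
qed

end

section \<open>The estimate on annuli implied by the Hardy inequality\<close>

text \<open>The bound is free of \<open>\<epsilon>\<close> and depends on \<open>l\<close> only
  through the factor 1/l. The exponents N - 2 and N/2 + 1 control, for all admissible
  \<open>l\<close> at once, the mass of the test function and the cross term in the expansion of its
  square. Both lie below N when N > 2, so finite \<open>q\<close> and \<open>k\<close> are
  available.\<close>

lemma annulus_bound_of_weighted_hardy:
  fixes \<mu> :: "'a::euclidean_space \<Rightarrow> real"
  defines "M \<equiv> weighted_measure \<mu>" and "N \<equiv> N0 \<mu>"
  assumes \<mu>: "locally_integrable lebesgue \<mu>"
    and \<epsilon>: "0 < \<epsilon>" "\<epsilon> < 1" and N: "2 < N" and l: "0 < l" "l < N - 2"
    and q: "0 \<le> q" "(\<integral>\<^sup>+x\<in>ball 0 1. ennreal (norm x powr - (N - 2)) \<partial>M) = ennreal q"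
    and k: "0 \<le> k" "(\<integral>\<^sup>+x\<in>ball 0 1. ennreal (norm x powr - (N / 2 + 1)) \<partial>M) = ennreal k"
    and hardy: "weighted_hardy \<mu> (c0 N) C (truncated_power \<epsilon> ((2 - N + l) / 2))
      (truncated_power_gradient \<epsilon> ((2 - N + l) / 2))"
  shows "(\<integral>\<^sup>+x\<in>ball 0 1 - cball 0 \<epsilon>. ennreal (norm x powr (l - N)) \<partial>M)
    \<le> ennreal (4 * (2 * c0 N * k + \<bar>C\<bar> * q) / (N - 2) / l)"
proof -
  define \<gamma> where "\<gamma> = (2 - N + l) / 2"
  have \<gamma>: "\<gamma> < 0" "2 * \<gamma> - 2 = l - N" using l by (auto simp: \<gamma>_def field_simps)
  define A where "A = ball (0::'a) 1 - cball 0 \<epsilon>"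
  let ?\<phi> = "truncated_power \<epsilon> \<gamma> :: 'a \<Rightarrow> real" and ?g = "truncated_power_gradient \<epsilon> \<gamma> :: 'a \<Rightarrow> 'a"
  define S where "S = (\<integral>\<^sup>+x\<in>A. ennreal (norm x powr (l - N)) \<partial>M)"
  define P where "P = (\<integral>\<^sup>+x. ennreal ((?\<phi> x)\<^sup>2) \<partial>M)"
  define H where "H = (\<integral>\<^sup>+x. ennreal ((?\<phi> x)\<^sup>2 / (norm x)\<^sup>2) \<partial>M)"
  have A[measurable]: "A \<in> sets M" by (auto simp: A_def M_def)
  have meas: "f \<in> borel_measurable M" if "f \<in> borel_measurable borel" for f :: "'a \<Rightarrow> real"
    using borel_measurable_weighted_measure[OF that] by (simp add: M_def)
  have [measurable]: "(\<lambda>x. norm x powr a) \<in> borel_measurable M" for a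
    by (rule meas) measurable
  have [measurable]: "(\<lambda>x. (?\<phi> x)\<^sup>2 / (norm x)\<^sup>2) \<in> borel_measurable M"
    by (rule meas) measurable
  \<comment> \<open>Squaring the norm of the gradient produces the exponent
    \<open>2 * \<gamma> - 2 = l - N\<close>, so the gradient term is an exact multiple of
    \<open>S\<close>.\<close>
  have G: "(\<integral>\<^sup>+x. ennreal ((norm (?g x))\<^sup>2) \<partial>M) = ennreal (\<gamma>\<^sup>2) * S"
  proof -
    have "ennreal ((norm (?g x))\<^sup>2) = ennreal (\<gamma>\<^sup>2) * (ennreal (norm x powr (l - N)) * indicator A x)" for x
    proof (cases "x \<in> A")
      case True
      have "(norm x powr (\<gamma> - 1))\<^sup>2 = norm x powr (l - N)"
        unfolding power2_eq_square powr_add[symmetric] \<gamma>(2)[symmetric] by simp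
      then show ?thesis using True
        by (simp add: A_def norm_truncated_power_gradient power_mult_distrib ennreal_mult)
    qed (auto simp: A_def norm_truncated_power_gradient)
    then show ?thesis unfolding S_def by (simp add: nn_integral_cmult)
  qed
  \<comment> \<open>The truncation keeps the integrand below \<open>\<epsilon> powr (l - N)\<close>,
    and compact sets have finite mass. Finiteness is what allows \<open>S\<close> to be subtracted
    later.\<close>
  have Sfin: "S < \<infinity>"
  proof -
    have "S \<le> (\<integral>\<^sup>+x. ennreal (\<epsilon> powr (l - N)) * indicator (cball 0 1) x \<partial>M)"
      unfolding S_def using l \<epsilon>
      by (intro nn_integral_mono) (auto simp: A_def indicator_def intro!: ennreal_leI powr_mono2')
    also have "\<dots> = ennreal (\<epsilon> powr (l - N)) * emeasure M (cball 0 1)"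
      by (intro nn_integral_cmult_indicator) (auto simp: M_def)
    also have "\<dots> < \<infinity>"
      using emeasure_weighted_measure_compact[OF \<mu> compact_cball[of 0 1]]
      by (auto simp: M_def ennreal_mult_less_top)
    finally show ?thesis .
  qed
  have P: "P \<le> ennreal q"
  proof -
    \<comment> \<open>The exponent \<open>2 * \<gamma> = l - (N - 2)\<close> exceeds
      \<open>- (N - 2)\<close>, which makes the power smaller inside the unit ball. The origin is
      left out because the test function is positive there while the power is 0.\<close>
    have "AE x in M. ennreal ((?\<phi> x)\<^sup>2) \<le> ennreal (norm x powr - (N - 2)) * indicator (ball 0 1) x"
      using AE_weighted_measure_nonzero[OF borel_measurable_of_locally_integrable[OF \<mu>], folded M_def]
    proof eventually_elim
      case (elim x)
      show ?case
      proof (cases "norm x < 1")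
        case True
        define m where "m = min 1 (max \<epsilon> (norm x))"
        have m: "norm x \<le> m" "0 < m" "m \<le> 1" using True \<epsilon> by (auto simp: m_def)
        have "1 powr \<gamma> \<le> m powr \<gamma>" "m powr \<gamma> \<le> norm x powr \<gamma>"
          using m elim \<gamma> by (intro powr_mono2'; simp)+
        then have "(?\<phi> x)\<^sup>2 \<le> (norm x powr \<gamma>)\<^sup>2"
          by (intro power_mono) (auto simp: truncated_power_def m_def)
        also have "\<dots> = norm x powr (2 * \<gamma>)"
          unfolding power2_eq_square powr_add[symmetric] by simp
        also have "\<dots> \<le> norm x powr - (N - 2)"
          using True l by (intro powr_mono') (auto simp: \<gamma>_def)
        finally show ?thesis using True by (simp add: ennreal_leI)
      qed (simp add: truncated_power_def)
    qed
    then have "P \<le> (\<integral>\<^sup>+x\<in>ball 0 1. ennreal (norm x powr - (N - 2)) \<partial>M)"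
      unfolding P_def by (rule nn_integral_mono_AE)
    then show ?thesis unfolding q(2) .
  qed
  \<comment> \<open>With t the power of the norm with exponent \<open>\<gamma>\<close>, this is t^2
    \<le> (t - 1)^2 + 2t divided by the squared norm. The cross term has exponent
    \<open>\<gamma> - 2 = l / 2 - (N / 2 + 1)\<close>, so on the annulus it is at most the power
    with exponent \<open>- (N / 2 + 1)\<close>.\<close>
  have H: "S \<le> H + 2 * ennreal k"
  proof -
    have "ennreal (norm x powr (l - N)) * indicator A x
        \<le> ennreal ((?\<phi> x)\<^sup>2 / (norm x)\<^sup>2) + 2 * (ennreal (norm x powr - (N / 2 + 1)) * indicator (ball 0 1) x)" for x
    proof (cases "x \<in> A")
      case True
      then have x: "\<epsilon> < norm x" "norm x < 1" "0 < norm x" using \<epsilon> by (auto simp: A_def)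
      define r where "r = norm x"
      have r: "0 < r" "r < 1" using x by (auto simp: r_def)
      have "r powr (l - N) = (r powr \<gamma>)\<^sup>2 / r\<^sup>2"
        unfolding \<gamma>(2)[symmetric] power2_eq_square powr_add[symmetric] using r
        by (simp add: powr_diff powr_numeral power2_eq_square)
      also have "\<dots> \<le> (r powr \<gamma> - 1)\<^sup>2 / r\<^sup>2 + 2 * (r powr \<gamma> / r\<^sup>2)"
        using r by (simp add: field_simps power2_eq_square)
      also have "r powr \<gamma> / r\<^sup>2 = r powr (\<gamma> - 2)"
        using r by (simp add: powr_diff powr_numeral)
      also have "r powr (\<gamma> - 2) \<le> r powr - (N / 2 + 1)"
        using r l by (intro powr_mono') (auto simp: \<gamma>_def)
      finally have "r powr (l - N) \<le> (?\<phi> x)\<^sup>2 / r\<^sup>2 + 2 * r powr - (N / 2 + 1)"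
        using x by (simp add: truncated_power_def r_def)
      then have "ennreal (r powr (l - N)) \<le> ennreal ((?\<phi> x)\<^sup>2 / r\<^sup>2 + 2 * r powr - (N / 2 + 1))"
        by (rule ennreal_leI)
      then show ?thesis using True x by (simp add: r_def ennreal_plus ennreal_mult)
    qed simp
    then have "S \<le> (\<integral>\<^sup>+x. (ennreal ((?\<phi> x)\<^sup>2 / (norm x)\<^sup>2)
        + 2 * (ennreal (norm x powr - (N / 2 + 1)) * indicator (ball 0 1) x)) \<partial>M)"
      unfolding S_def by (rule nn_integral_mono)
    also have "\<dots> = H + 2 * ennreal k"
    proof -
      have [measurable]: "ball 0 1 \<in> sets M" by (simp add: M_def)
      show ?thesis unfolding H_def k(2)[symmetric]
        by (subst nn_integral_add) (auto simp: nn_integral_cmult)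
    qed
    finally show ?thesis .
  qed
  obtain s where s: "0 \<le> s" "S = ennreal s" using Sfin by (cases S) auto
  obtain p where p: "0 \<le> p" "P = ennreal p" "p \<le> q"
    using P q(1) by (cases P) (auto simp: ennreal_le_iff top_unique)
  have c: "0 < c0 N" using N by (simp add: c0_def)
  have "ereal (c0 N) * enn2ereal H \<le> enn2ereal (ennreal (\<gamma>\<^sup>2) * S) + ereal C * enn2ereal P"
    using hardy unfolding weighted_hardy_def H_def P_def M_def[symmetric] \<gamma>_def[symmetric] G .
  also have "\<dots> = ereal (\<gamma>\<^sup>2 * s + C * p)"
    using s p by (simp add: ennreal_mult[symmetric] enn2ereal_ennreal)
  finally have hs: "ereal (c0 N) * enn2ereal H \<le> ereal (\<gamma>\<^sup>2 * s + C * p)" .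
  \<comment> \<open>A finite right-hand side together with \<open>c0 N > 0\<close> excludes an
    infinite \<open>H\<close>; from here on the inequality is one between reals.\<close>
  then obtain h where h: "0 \<le> h" "H = ennreal h"
    using c by (cases H) auto
  have "c0 N * h \<le> \<gamma>\<^sup>2 * s + C * p"
    using hs h by (simp add: enn2ereal_ennreal)
  \<comment> \<open>The sign of \<open>C\<close> is unknown, so \<open>p\<close> is replaced by its
    bound \<open>q\<close> only after passing to the absolute value.\<close>
  also have "C * p \<le> \<bar>C\<bar> * q"
    using p by (intro mult_mono) auto
  finally have 1: "c0 N * h \<le> \<gamma>\<^sup>2 * s + \<bar>C\<bar> * q" by simp
  have "ennreal s \<le> ennreal (h + 2 * k)"
    using H h k(1) s by (simp add: ennreal_plus ennreal_mult)
  then have "s \<le> h + 2 * k" using h k(1) by (simp add: ennreal_le_iff del: ennreal_plus)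
  then have "c0 N * s \<le> c0 N * (h + 2 * k)" using c by simp
  with 1 have 2: "(c0 N - \<gamma>\<^sup>2) * s \<le> 2 * c0 N * k + \<bar>C\<bar> * q" by (simp add: algebra_simps)
  \<comment> \<open>A difference of squares, as \<open>\<gamma> = - (N - 2 - l) / 2\<close>. The
    condition \<open>l < N - 2\<close> then gives the lower bound that is linear in
    \<open>l\<close>.\<close>
  have "c0 N - \<gamma>\<^sup>2 = l * (2 * (N - 2) - l) / 4"
    by (simp add: c0_def \<gamma>_def power2_eq_square field_simps)
  also have "\<dots> \<ge> l * (N - 2) / 4" using l by simp
  finally have "l * (N - 2) / 4 * s \<le> (c0 N - \<gamma>\<^sup>2) * s" using s by (intro mult_right_mono) auto
  with 2 have "l * (N - 2) / 4 * s \<le> 2 * c0 N * k + \<bar>C\<bar> * q" by simp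
  then have "s \<le> 4 * (2 * c0 N * k + \<bar>C\<bar> * q) / (N - 2) / l"
    using l N by (simp add: field_simps)
  then show ?thesis using s unfolding S_def A_def by (simp add: ennreal_leI)
qed

section \<open>Removing the truncation and reaching the contradiction\<close>

text \<open>Monotone convergence: the annuli increase to the punctured ball, and
  \<open>f 0 = 0\<close> makes the integrand vanish at the origin.\<close>

lemma nn_integral_ball_le_if_annuli_le:
  fixes f :: "'a::real_normed_vector \<Rightarrow> ennreal"
  assumes [measurable]: "f \<in> borel_measurable M" and sets: "sets borel \<subseteq> sets M" and "f 0 = 0"
    and le: "\<And>\<epsilon>. 0 < \<epsilon> \<Longrightarrow> \<epsilon> < r \<Longrightarrow> (\<integral>\<^sup>+x\<in>ball 0 r - cball 0 \<epsilon>. f x \<partial>M) \<le> B" and r: "0 < r"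
  shows "(\<integral>\<^sup>+x\<in>ball 0 r. f x \<partial>M) \<le> B"
proof -
  \<comment> \<open>The shift by 2 keeps every radius strictly below \<open>r\<close>, as the bound
    on annuli requires.\<close>
  define e where "e n = r / real (n + 2)" for n
  have e: "0 < e n" "e n < r" for n using r by (auto simp: e_def field_simps add_pos_nonneg)
  have e0: "e \<longlonglongrightarrow> 0"
    unfolding e_def by (rule LIMSEQ_ignore_initial_segment[OF lim_const_over_n])
  have dec: "e n \<le> e m" if "m \<le> n" for m n
    using that r by (auto simp: e_def intro!: divide_left_mono)
  have "(\<lambda>n. \<integral>\<^sup>+x. f x * indicator (ball 0 r - cball 0 (e n)) x \<partial>M) \<longlonglongrightarrow> (\<integral>\<^sup>+x\<in>ball 0 r. f x \<partial>M)"
  proof (rule nn_integral_LIMSEQ)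
    show "incseq (\<lambda>n x. f x * indicator (ball 0 r - cball 0 (e n)) x)"
      using dec by (fastforce simp: incseq_def le_fun_def indicator_def)
    have "ball 0 r - cball 0 (e n) \<in> sets M" for n using sets by auto
    then show "(\<lambda>x. f x * indicator (ball 0 r - cball 0 (e n)) x) \<in> borel_measurable M" for n
      by measurable
    fix x
    show "(\<lambda>n. f x * indicator (ball 0 r - cball 0 (e n)) x) \<longlonglongrightarrow> f x * indicator (ball 0 r) x"
    proof (cases "x = 0")
      case False
      then have "\<forall>\<^sub>F n in sequentially. e n < norm x"
        using order_tendstoD(2)[OF e0] by simp
      then show ?thesis
        by (intro tendsto_eventually) (elim eventually_mono, auto simp: indicator_def)
    qed (simp add: \<open>f 0 = 0\<close>)
  qed
  then show ?thesis
    using le e by (intro LIMSEQ_le_const2) auto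
qed

theorem theorem4p3:
  fixes \<mu> :: "'a::euclidean_space \<Rightarrow> real"
  assumes "locally_integrable lebesgue \<mu>"
    and "AE x in lebesgue. 0 \<le> \<mu> x"
    and "integrable_exponents \<mu> \<noteq> {}" and "bdd_above (integrable_exponents \<mu>)"
    and "Limsup (at_right 0)
           (\<lambda>l. ennreal l *
              (\<integral>\<^sup>+x\<in>ball 0 1. ennreal (norm x powr (l - N0 \<mu>)) \<partial>weighted_measure \<mu>)) = \<infinity>"
    and "N0 \<mu> > 2"
  shows "\<forall>C. \<exists>\<phi>\<in>H1 \<mu>. \<exists>g. has_weak_gradient \<phi> g \<and> \<not> weighted_hardy \<mu> (c0 (N0 \<mu>)) C \<phi> g"
proof (rule ccontr)
  let ?N = "N0 \<mu>" and ?M = "weighted_measure \<mu>"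
  assume "\<not> ?thesis"
  then obtain C where hardy: "\<And>\<phi> g. \<phi> \<in> H1 \<mu> \<Longrightarrow> has_weak_gradient \<phi> g \<Longrightarrow> weighted_hardy \<mu> (c0 ?N) C \<phi> g"
    by blast
  \<comment> \<open>Both exponents, N - 2 here and N/2 + 1 below, are smaller than N, the second
    because N > 2, so the two integrals are finite.\<close>
  obtain q where q: "0 \<le> q" "(\<integral>\<^sup>+x\<in>ball 0 1. ennreal (norm x powr - (?N - 2)) \<partial>?M) = ennreal q"
    using nn_integral_powr_ball_finite[OF assms(3,4), of "?N - 2"]
    by (cases "\<integral>\<^sup>+x\<in>ball 0 1. ennreal (norm x powr - (?N - 2)) \<partial>?M") auto
  obtain k where k: "0 \<le> k" "(\<integral>\<^sup>+x\<in>ball 0 1. ennreal (norm x powr - (?N / 2 + 1)) \<partial>?M) = ennreal k"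
    using nn_integral_powr_ball_finite[OF assms(3,4), of "?N / 2 + 1"] assms(6)
    by (cases "\<integral>\<^sup>+x\<in>ball 0 1. ennreal (norm x powr - (?N / 2 + 1)) \<partial>?M") auto
  define B where "B = 4 * (2 * c0 ?N * k + \<bar>C\<bar> * q) / (?N - 2)"
  have "ennreal l * (\<integral>\<^sup>+x\<in>ball 0 1. ennreal (norm x powr (l - ?N)) \<partial>?M) \<le> ennreal B"
    if l: "0 < l" "l < ?N - 2" for l
  proof -
    have \<gamma>: "(2 - ?N + l) / 2 < 0" using l by simp
    have "(\<integral>\<^sup>+x\<in>ball 0 1. ennreal (norm x powr (l - ?N)) \<partial>?M) \<le> ennreal (B / l)"
    \<comment> \<open>Here \<open>\<epsilon>\<close> disappears: the bound \<open>B / l\<close> on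
      the annuli does not depend on it.\<close>
    proof (rule nn_integral_ball_le_if_annuli_le)
      show "(\<lambda>x::'a. ennreal (norm x powr (l - ?N))) \<in> borel_measurable ?M"
        by (intro measurable_compose[OF borel_measurable_weighted_measure measurable_ennreal]) measurable
      show "sets borel \<subseteq> sets ?M" by auto
      fix \<epsilon> :: real
      assume \<epsilon>: "0 < \<epsilon>" "\<epsilon> < 1"
      show "(\<integral>\<^sup>+x\<in>ball 0 1 - cball 0 \<epsilon>. ennreal (norm x powr (l - ?N)) \<partial>?M) \<le> ennreal (B / l)"
        unfolding B_def
        by (rule annulus_bound_of_weighted_hardy[OF assms(1) \<epsilon> assms(6) l q k])
           (intro hardy truncated_power_in_H1 has_weak_gradient_truncated_power \<epsilon> \<gamma> assms(1))
    qed auto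
    then have "ennreal l * (\<integral>\<^sup>+x\<in>ball 0 1. ennreal (norm x powr (l - ?N)) \<partial>?M) \<le> ennreal l * ennreal (B / l)"
      by (rule mult_left_mono) simp
    also have "\<dots> = ennreal B"
      using l by (simp add: ennreal_mult'[symmetric])
    finally show ?thesis .
  qed
  \<comment> \<open>The bound holds on the whole interval from 0 to N - 2, hence near 0, so it
    passes to the limsup, which was assumed infinite.\<close>
  then have "\<forall>\<^sub>F l in at_right 0. ennreal l *
      (\<integral>\<^sup>+x\<in>ball 0 1. ennreal (norm x powr (l - ?N)) \<partial>?M) \<le> ennreal B"
    using assms(6) by (auto simp: eventually_at_right_field intro!: exI[of _ "?N - 2"])
  then have "Limsup (at_right 0)
      (\<lambda>l. ennreal l * (\<integral>\<^sup>+x\<in>ball 0 1. ennreal (norm x powr (l - ?N)) \<partial>?M)) \<le> ennreal B"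
    by (rule Limsup_bounded)
  with assms(5) show False by (simp add: top_unique)
qed

end
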